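(* Let $R$ be a ring, $\mathfrak{a}$ an ideal of $R$, $S\in\mathrm{Den}_l(R,\mathfrak{a})$ and $\mathfrak{b}$ be an ideal of $R$. Then the following statements are equivalent: 1. The left ideal $S^{-1}\mathfrak{b}$ of the ring $S^{-1}R$ is an ideal. 2. For all elements $s\in S$, $\mathfrak{b}s^{-1}\subseteq S^{-1}\mathfrak{b}$. 3. If $rs\in\mathfrak{b}$ for some elements $r\in R$ and $s\in S$ then $s'r\in\mathfrak{b}$ for some $s'\in S$. 4. If $rs\in\mathfrak{a}+\mathfrak{b}$ for some elements $s\in S$ and $r\in R$ then $s'r\in\mathfrak{a}+\mathfrak{b}$ for some $s'\in S$. 5. $\mathrm{tor}_{r,\overline{S}}(\overline{R}/\pi_{\mathfrak{a}}(\mathfrak{b}))\subseteq\mathrm{tor}_{l,\overline{S}}(\overline{R}/\pi_{\mathfrak{a}}(\mathfrak{b}))$. 6. For each $s\in S$, the ascending chain of left ideals of the ring $S^{-1}R$, $\mathfrak{b}_0'\subseteq\mathfrak{b}_1'\subseteq\cdots\subseteq\mathfrak{b}_i'\subseteq\cdots$, stabilizes, where $\mathfrak{b}_i':=\sum_{j=0}^iS^{-1}\mathfrak{b}s^{-j}$ for $i\geq0$.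
   Context: Rings are associative with $1$; "ideal" means two-sided ideal. A multiplicative subset $S$ of $R$ is a multiplicative subsemigroup with $1\in S$, $0\notin S$. It is a left Ore set if $Sr\cap Rs\neq\emptyset$ for all $r\in R$, $s\in S$; then $\mathrm{ass}_l(S)=\{r\in R\mid sr=0 \text{ for some } s\in S\}$ is an ideal. A left Ore set $S$ is a left denominator set if $rs=0$ with $r\in R$, $s\in S$ implies $tr=0$ for some $t\in S$. $\mathrm{Den}_l(R,\mathfrak{a})$ is the set of left denominator sets $S$ of $R$ with $\mathrm{ass}_l(S)=\mathfrak{a}$. $S^{-1}R=\{s^{-1}r\mid s\in S,r\in R\}$ is the left localization; for a left ideal $I$ of $R$, $S^{-1}I=\{s^{-1}i\mid s\in S,i\in I\}$ is a left ideal of $S^{-1}R$. In statement 2, $\mathfrak{b}s^{-1}=\{\frac{b}{1}\cdot s^{-1}\mid b\in\mathfrak{b}\}\subseteq S^{-1}R$. Notation: $\overline{R}:=R/\mathfrak{a}$, $\pi_{\mathfrak{a}}:R\to\overline{R}$, $r\mapsto r+\mathfrak{a}$, $\overline{S}:=\pi_{\mathfrak{a}}(S)$. For a right module $M$ and a multiplicative set $T$, $\mathrm{tor}_{r,T}(M)=\{m\in M\mid mt=0\text{ for some }t\in T\}$ (a subset, in general not a submodule); for a left module $M$, $\mathrm{tor}_{l,T}(M)=\{m\in M\mid tm=0\text{ for some }t\in T\}$. *)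

theory Defs
  imports "HOL-Algebra.Algebra"
begin

definition mult_subset :: "('a, 'm) ring_scheme \<Rightarrow> 'a set \<Rightarrow> bool" where
  "mult_subset R S \<longleftrightarrow>
     S \<subseteq> carrier R \<and> \<one>\<^bsub>R\<^esub> \<in> S \<and> \<zero>\<^bsub>R\<^esub> \<notin> S \<and>
     (\<forall>s\<in>S. \<forall>t\<in>S. s \<otimes>\<^bsub>R\<^esub> t \<in> S)"

text \<open>\<open>S #> r\<close> and \<open>carrier R #> s\<close> are the sets \<open>Sr\<close> and \<open>Rs\<close> for the multiplicative
  monoid of \<open>R\<close>.\<close>

definition left_Ore_set :: "('a, 'm) ring_scheme \<Rightarrow> 'a set \<Rightarrow> bool" where
  "left_Ore_set R S \<longleftrightarrow>
     mult_subset R S \<and>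
     (\<forall>r\<in>carrier R. \<forall>s\<in>S. (S #>\<^bsub>R\<^esub> r) \<inter> (carrier R #>\<^bsub>R\<^esub> s) \<noteq> {})"

definition ass_l :: "('a, 'm) ring_scheme \<Rightarrow> 'a set \<Rightarrow> 'a set" where
  "ass_l R S = {r \<in> carrier R. \<exists>s\<in>S. s \<otimes>\<^bsub>R\<^esub> r = \<zero>\<^bsub>R\<^esub>}"

definition left_denominator_set :: "('a, 'm) ring_scheme \<Rightarrow> 'a set \<Rightarrow> bool" where
  "left_denominator_set R S \<longleftrightarrow>
     left_Ore_set R S \<and>
     (\<forall>r\<in>carrier R. \<forall>s\<in>S. r \<otimes>\<^bsub>R\<^esub> s = \<zero>\<^bsub>R\<^esub> \<longrightarrow> (\<exists>t\<in>S. t \<otimes>\<^bsub>R\<^esub> r = \<zero>\<^bsub>R\<^esub>))"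

definition Den_l :: "('a, 'm) ring_scheme \<Rightarrow> 'a set \<Rightarrow> 'a set set" where
  "Den_l R \<aa> = {S. left_denominator_set R S \<and> ass_l R S = \<aa>}"

text \<open>The left localization, which is determined only up to a unique isomorphism over \<open>R\<close>, is
  treated as a ring \<open>Q\<close> together with the canonical map \<open>\<phi>: r \<mapsto> r/1\<close>. The conditions below are
  the usual definition of a left quotient ring of \<open>R\<close> with respect to \<open>S\<close>; by Ore's theorem
  such a pair exists exactly when the multiplicative set \<open>S\<close> is a left denominator set.\<close>

definition is_left_localization ::
    "('a, 'm) ring_scheme \<Rightarrow> 'a set \<Rightarrow> ('b, 'k) ring_scheme \<Rightarrow> ('a \<Rightarrow> 'b) \<Rightarrow> bool" where
  "is_left_localization R S Q \<phi> \<longleftrightarrow>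
     ring Q \<and> \<phi> \<in> ring_hom R Q \<and>
     (\<forall>s\<in>S. \<phi> s \<in> Units Q) \<and>
     carrier Q = {inv\<^bsub>Q\<^esub> (\<phi> s) \<otimes>\<^bsub>Q\<^esub> \<phi> r | s r. s \<in> S \<and> r \<in> carrier R} \<and>
     a_kernel R Q \<phi> = ass_l R S"

text \<open>\<open>S\<^sup>-\<^sup>1I\<close> as a subset of the localization \<open>(Q, \<phi>)\<close>.\<close>

definition loc_ideal :: "('b, 'k) ring_scheme \<Rightarrow> ('a \<Rightarrow> 'b) \<Rightarrow> 'a set \<Rightarrow> 'a set \<Rightarrow> 'b set" where
  "loc_ideal Q \<phi> S I = {inv\<^bsub>Q\<^esub> (\<phi> s) \<otimes>\<^bsub>Q\<^esub> \<phi> i | s i. s \<in> S \<and> i \<in> I}"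

text \<open>\<open>\<Sum>\<^sub>j\<^sub>\<le>\<^sub>i S\<^sup>-\<^sup>1I s\<^sup>-\<^sup>j\<close>, as the set of sums of one element from each summand.\<close>

definition loc_chain ::
    "('b, 'k) ring_scheme \<Rightarrow> ('a \<Rightarrow> 'b) \<Rightarrow> 'a set \<Rightarrow> 'a set \<Rightarrow> 'a \<Rightarrow> nat \<Rightarrow> 'b set" where
  "loc_chain Q \<phi> S I s i =
     {finsum Q f {..i} | f.
        \<forall>j\<le>i. f j \<in> loc_ideal Q \<phi> S I #>\<^bsub>Q\<^esub> (inv\<^bsub>Q\<^esub> (\<phi> s) [^]\<^bsub>Q\<^esub> j)}"

text \<open>HOL-Algebra has modules over commutative rings only. The torsion subsets therefore take the
  scalar action as an argument, and only the carrier and zero of \<open>M\<close> are used.\<close>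

definition tor_r :: "('b, 'k) ring_scheme \<Rightarrow> ('b \<Rightarrow> 'a \<Rightarrow> 'b) \<Rightarrow> 'a set \<Rightarrow> 'b set" where
  "tor_r M act T = {m \<in> carrier M. \<exists>t\<in>T. act m t = \<zero>\<^bsub>M\<^esub>}"

definition tor_l :: "('b, 'k) ring_scheme \<Rightarrow> ('a \<Rightarrow> 'b \<Rightarrow> 'b) \<Rightarrow> 'a set \<Rightarrow> 'b set" where
  "tor_l M act T = {m \<in> carrier M. \<exists>t\<in>T. act t m = \<zero>\<^bsub>M\<^esub>}"

text \<open>The right and left actions of \<open>R\<close> on \<open>R/I\<close>: \<open>(I + x)\<cdot>t = I + xt\<close> and
  \<open>t\<cdot>(I + x) = I + tx\<close>.\<close>

definition quot_ract :: "('a, 'm) ring_scheme \<Rightarrow> 'a set \<Rightarrow> 'a set \<Rightarrow> 'a \<Rightarrow> 'a set" where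
  "quot_ract R I m t = m \<otimes>\<^bsub>R Quot I\<^esub> (I +>\<^bsub>R\<^esub> t)"

definition quot_lact :: "('a, 'm) ring_scheme \<Rightarrow> 'a set \<Rightarrow> 'a \<Rightarrow> 'a set \<Rightarrow> 'a set" where
  "quot_lact R I t m = (I +>\<^bsub>R\<^esub> t) \<otimes>\<^bsub>R Quot I\<^esub> m"

end

theory Submission
  imports Defs
begin

text \<open>Everything rests on three remarks. The element \<open>r/1\<close> lies in \<open>S\<^sup>-\<^sup>1I\<close> iff \<open>s'r \<in> I\<close> for some
  \<open>s' \<in> S\<close>; the set \<open>S\<^sup>-\<^sup>1\<bb>\<close> is always a left ideal that is stable under right multiplication by
  the image of \<open>R\<close>; and every element of \<open>S\<^sup>-\<^sup>1R\<close> is a product of such images and of inverses of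
  images of elements of \<open>S\<close>. Hence \<open>S\<^sup>-\<^sup>1\<bb>\<close> is an ideal iff it absorbs \<open>s\<^sup>-\<^sup>1\<close> on the right, which the
  Ore condition turns into a torsion condition on \<open>R/\<bb>\<close>. If the chain for \<open>s\<close> stabilizes at \<open>n\<close>,
  multiply \<open>\<bb>s\<^sup>-\<^sup>n\<^sup>-\<^sup>1 \<subseteq> \<bb>'\<^sub>n\<close> by \<open>s\<^sup>n\<close> on the right.\<close>

section \<open>Cancellation and powers of units in a monoid\<close>

lemma (in monoid) Units_l_inv_cancel:
  "\<lbrakk>u \<in> Units G; x \<in> carrier G\<rbrakk> \<Longrightarrow> inv u \<otimes> (u \<otimes> x) = x"
  by (simp add: m_assoc[symmetric] Units_closed)

lemma (in monoid) Units_r_inv_cancel: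
  "\<lbrakk>u \<in> Units G; x \<in> carrier G\<rbrakk> \<Longrightarrow> u \<otimes> (inv u \<otimes> x) = x"
  by (simp add: m_assoc[symmetric] Units_closed)

text \<open>Splitting \<open>u^n\<close> as \<open>u^j u^(n-j)\<close> lets \<open>u^-j\<close>
  cancel the first factor. With \<open>u\<close> the image of \<open>s\<close>, this turns the
  negative powers in the chain into nonnegative ones.\<close>

lemma (in monoid) Units_inv_pow_mult_pow:
  fixes j n :: nat
  assumes "u \<in> Units G" "j \<le> n"
  shows "inv u [^] j \<otimes> u [^] n = u [^] (n - j)"
proof -
  have u: "u \<in> carrier G" using assms(1) by (rule Units_closed)
  have "inv u [^] j \<otimes> u [^] j = \<one>" for j :: nat
  proof (induction j)
    case (Suc j)
    \<comment> \<open>The positive power is unfolded at its left end, so that \<open>inv u\<close>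
      and \<open>u\<close> meet in the middle of the product.\<close>
    have "inv u [^] Suc j \<otimes> u [^] Suc j
        = inv u [^] j \<otimes> inv u \<otimes> (u \<otimes> u [^] j)"
      using nat_pow_Suc2[OF u, of j] by (simp add: u)
    also have "\<dots> = inv u [^] j \<otimes> (inv u \<otimes> u) \<otimes> u [^] j"
      using assms(1) u by (simp only: m_assoc m_closed nat_pow_closed Units_inv_closed)
    finally show ?case using Suc assms by simp
  qed simp
  moreover have "u [^] n = u [^] j \<otimes> u [^] (n - j)"
    using assms(2) nat_pow_mult[OF u, of j "n - j"] by simp
  ultimately show ?thesis using assms(1) u by (simp add: m_assoc[symmetric])
qed

section \<open>The iterated quotient and its torsion subsets\<close>

lemma (in ideal) a_r_coset_eq_iff:
  assumes "r \<in> carrier R"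
  shows "I +> r = I \<longleftrightarrow> r \<in> I"
  using assms a_rcos_const a_rcos_self by blast

text \<open>The coset is zero exactly when the class of \<open>r\<close> lies in the image of
  \<open>J\<close> in \<open>R/I\<close>, and the preimage of that image in \<open>R\<close> is
  \<open>I + J\<close>.\<close>

lemma (in ring) quot_quot_zero_iff:
  assumes I: "ideal I R" and J: "ideal J R" and r: "r \<in> carrier R"
  shows "(+>) I ` J +>\<^bsub>R Quot I\<^esub> (I +> r) = (+>) I ` J \<longleftrightarrow> r \<in> I <+>\<^bsub>R\<^esub> J"
proof -
  interpret I: ideal I R by fact
  interpret J: ideal J R by fact
  interpret IJ: ideal "(+>) I ` J" "R Quot I"
    using ring_ideal_imp_quot_ideal I J by blast
  have "I +> r \<in> carrier (R Quot I)"
    using r by (rule ring_hom_closed[OF I.rcos_ring_hom])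
  then have "(+>) I ` J +>\<^bsub>R Quot I\<^esub> (I +> r) = (+>) I ` J \<longleftrightarrow> I +> r \<in> (+>) I ` J"
    by (rule IJ.a_r_coset_eq_iff)
  also have "\<dots> \<longleftrightarrow> r \<in> I <+>\<^bsub>R\<^esub> J"
  proof
    assume "I +> r \<in> (+>) I ` J"
    then obtain j where j: "j \<in> J" "I +> r = I +> j" by blast
    then have "r \<in> I +> j" using r I.a_rcos_self by blast
    then show "r \<in> I <+>\<^bsub>R\<^esub> J" using j by (auto simp: a_r_coset_def' set_add_def')
  next
    assume "r \<in> I <+>\<^bsub>R\<^esub> J"
    then obtain i j where ij: "i \<in> I" "j \<in> J" "r = i \<oplus> j" by (auto simp: set_add_def')
    then have "r \<in> I +> j" by (auto simp: a_r_coset_def')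
    then have "I +> j = I +> r" using ij by (intro I.a_repr_independence') auto
    then show "I +> r \<in> (+>) I ` J" using ij by blast
  qed
  finally show ?thesis .
qed

text \<open>Both actions multiply representatives, and a class vanishes iff its representative lies
  in \<open>I + J\<close>. For \<open>I = \<aa>\<close> and \<open>J = \<bb>\<close> this identifies
  statement 5 with statement 4.\<close>

lemma (in ring) tor_quot_quot_subset_iff:
  assumes I: "ideal I R" and J: "ideal J R" and S: "S \<subseteq> carrier R"
  defines "\<pi> \<equiv> (+>) I"
  shows "tor_r (R Quot I Quot \<pi> ` J) (quot_ract (R Quot I) (\<pi> ` J)) (\<pi> ` S)
          \<subseteq> tor_l (R Quot I Quot \<pi> ` J) (quot_lact (R Quot I) (\<pi> ` J)) (\<pi> ` S) \<longleftrightarrow>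
    (\<forall>r\<in>carrier R. \<forall>s\<in>S. r \<otimes> s \<in> I <+>\<^bsub>R\<^esub> J \<longrightarrow> (\<exists>s'\<in>S. s' \<otimes> r \<in> I <+>\<^bsub>R\<^esub> J))"
proof -
  interpret I: ideal I R by fact
  interpret IJ: ideal "\<pi> ` J" "R Quot I"
    unfolding \<pi>_def using ring_ideal_imp_quot_ideal I J by blast
  let ?M = "R Quot I Quot \<pi> ` J"
  define q where "q = (\<lambda>r. \<pi> ` J +>\<^bsub>R Quot I\<^esub> \<pi> r)"
  have \<pi>: "\<pi> \<in> ring_hom R (R Quot I)"
    unfolding \<pi>_def by (rule I.rcos_ring_hom)
  have carrier: "carrier ?M = q ` carrier R"
    by (auto simp: FactRing_def A_RCOSETS_def' \<pi>_def q_def)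
  have mult: "q x \<otimes>\<^bsub>?M\<^esub> q y = q (x \<otimes> y)" if "x \<in> carrier R" "y \<in> carrier R" for x y
    using that IJ.rcoset_mult_add ring_hom_mult[OF \<pi>] ring_hom_closed[OF \<pi>]
    by (simp add: FactRing_def[of "R Quot I"] q_def)
  have zero: "q r = \<zero>\<^bsub>?M\<^esub> \<longleftrightarrow> r \<in> I <+>\<^bsub>R\<^esub> J" if "r \<in> carrier R" for r
    using quot_quot_zero_iff[OF I J that] by (simp add: \<pi>_def q_def FactRing_def[of "R Quot I"])
  have right: "q r \<in> tor_r ?M (quot_ract (R Quot I) (\<pi> ` J)) (\<pi> ` S)
      \<longleftrightarrow> (\<exists>s\<in>S. r \<otimes> s \<in> I <+>\<^bsub>R\<^esub> J)" if r: "r \<in> carrier R" for r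
  proof -
    have "quot_ract (R Quot I) (\<pi> ` J) (q r) (\<pi> s) = \<zero>\<^bsub>?M\<^esub> \<longleftrightarrow> r \<otimes> s \<in> I <+>\<^bsub>R\<^esub> J"
      if "s \<in> S" for s
      using mult[of r s] zero[of "r \<otimes> s"] r that S by (auto simp: quot_ract_def q_def)
    then show ?thesis using r by (simp add: tor_r_def carrier)
  qed
  have left: "q r \<in> tor_l ?M (quot_lact (R Quot I) (\<pi> ` J)) (\<pi> ` S)
      \<longleftrightarrow> (\<exists>s\<in>S. s \<otimes> r \<in> I <+>\<^bsub>R\<^esub> J)" if r: "r \<in> carrier R" for r
  proof -
    have "quot_lact (R Quot I) (\<pi> ` J) (\<pi> s) (q r) = \<zero>\<^bsub>?M\<^esub> \<longleftrightarrow> s \<otimes> r \<in> I <+>\<^bsub>R\<^esub> J"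
      if "s \<in> S" for s
      using mult[of s r] zero[of "s \<otimes> r"] r that S by (auto simp: quot_lact_def q_def)
    then show ?thesis using r by (simp add: tor_l_def carrier)
  qed
  \<comment> \<open>All torsion elements are classes \<open>q r\<close>, so the inclusion can be
    tested on representatives.\<close>
  have "tor_r ?M (quot_ract (R Quot I) (\<pi> ` J)) (\<pi> ` S) \<subseteq> q ` carrier R"
    by (auto simp: tor_r_def carrier)
  then have "tor_r ?M (quot_ract (R Quot I) (\<pi> ` J)) (\<pi> ` S)
      \<subseteq> tor_l ?M (quot_lact (R Quot I) (\<pi> ` J)) (\<pi> ` S) \<longleftrightarrow>
    (\<forall>r\<in>carrier R. q r \<in> tor_r ?M (quot_ract (R Quot I) (\<pi> ` J)) (\<pi> ` S) \<longrightarrow>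
      q r \<in> tor_l ?M (quot_lact (R Quot I) (\<pi> ` J)) (\<pi> ` S))"
    by auto
  also have "\<dots> \<longleftrightarrow>
      (\<forall>r\<in>carrier R. \<forall>s\<in>S. r \<otimes> s \<in> I <+>\<^bsub>R\<^esub> J \<longrightarrow> (\<exists>s'\<in>S. s' \<otimes> r \<in> I <+>\<^bsub>R\<^esub> J))"
    using right left by auto
  finally show ?thesis .
qed

section \<open>Arithmetic in a left localization of a ring\<close>

locale left_localization = ring_hom_ring R Q \<phi>
  for R (structure) and Q (structure) and \<phi> +
  fixes S
  assumes denominator: "left_denominator_set R S"
    and localization: "is_left_localization R S Q \<phi>"
begin

lemma S_subset: "S \<subseteq> carrier R"
  and S_one: "\<one> \<in> S"
  and S_mult: "\<lbrakk>s \<in> S; t \<in> S\<rbrakk> \<Longrightarrow> s \<otimes> t \<in> S"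
  using denominator
  by (auto simp: left_denominator_set_def left_Ore_set_def mult_subset_def)

lemma S_carrier [simp]: "s \<in> S \<Longrightarrow> s \<in> carrier R"
  using S_subset by blast

lemma Ore:
  assumes "r \<in> carrier R" "s \<in> S"
  obtains s' r' where "s' \<in> S" "r' \<in> carrier R" "s' \<otimes> r = r' \<otimes> s"
proof -
  have "(S #> r) \<inter> (carrier R #> s) \<noteq> {}"
    using assms denominator by (auto simp: left_denominator_set_def left_Ore_set_def)
  then show ?thesis using that by (fastforce simp: r_coset_def)
qed

lemma unit [simp]: "s \<in> S \<Longrightarrow> \<phi> s \<in> Units Q"
  using localization unfolding is_left_localization_def by blast

lemma carrier_Q: "carrier Q = {inv\<^bsub>Q\<^esub> (\<phi> s) \<otimes>\<^bsub>Q\<^esub> \<phi> r | s r. s \<in> S \<and> r \<in> carrier R}"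
  using localization unfolding is_left_localization_def by blast

lemma phi_eq_zero_iff: "r \<in> carrier R \<Longrightarrow> \<phi> r = \<zero>\<^bsub>Q\<^esub> \<longleftrightarrow> (\<exists>s\<in>S. s \<otimes> r = \<zero>)"
  using localization unfolding is_left_localization_def a_kernel_def' ass_l_def by blast

text \<open>Multiply the image of \<open>s' r = r' s\<close> by the inverse of
  \<open>\<phi> s'\<close> on the left and that of \<open>\<phi> s\<close> on the right. Together
  with \<open>Ore\<close>, this turns every right fraction into a left one.\<close>

lemma mult_inv_eq:
  assumes "s \<in> S" "s' \<in> S" "r \<in> carrier R" "r' \<in> carrier R" "s' \<otimes> r = r' \<otimes> s"
  shows "\<phi> r \<otimes>\<^bsub>Q\<^esub> inv\<^bsub>Q\<^esub> (\<phi> s) = inv\<^bsub>Q\<^esub> (\<phi> s') \<otimes>\<^bsub>Q\<^esub> \<phi> r'"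
proof -
  have eq: "\<phi> s' \<otimes>\<^bsub>Q\<^esub> \<phi> r = \<phi> r' \<otimes>\<^bsub>Q\<^esub> \<phi> s"
    using arg_cong[OF assms(5), of \<phi>] assms(1-4) by simp
  have "\<phi> r \<otimes>\<^bsub>Q\<^esub> inv\<^bsub>Q\<^esub> (\<phi> s)
      = inv\<^bsub>Q\<^esub> (\<phi> s') \<otimes>\<^bsub>Q\<^esub> (\<phi> s' \<otimes>\<^bsub>Q\<^esub> \<phi> r) \<otimes>\<^bsub>Q\<^esub> inv\<^bsub>Q\<^esub> (\<phi> s)"
    using assms by (simp add: S.m_assoc[symmetric])
  also have "\<dots> = inv\<^bsub>Q\<^esub> (\<phi> s') \<otimes>\<^bsub>Q\<^esub> \<phi> r'"
    unfolding eq using assms by (simp add: S.m_assoc)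
  finally show ?thesis .
qed

section \<open>Closure properties of the left ideal generated by an ideal in the
  localization\<close>

context
  fixes I
  assumes I: "ideal I R"
begin

interpretation I: ideal I R by (rule I)

abbreviation "L \<equiv> loc_ideal Q \<phi> S I"

lemma loc_idealI: "\<lbrakk>s \<in> S; i \<in> I\<rbrakk> \<Longrightarrow> inv\<^bsub>Q\<^esub> (\<phi> s) \<otimes>\<^bsub>Q\<^esub> \<phi> i \<in> L"
  by (auto simp: loc_ideal_def)

lemma loc_idealE:
  assumes "x \<in> L"
  obtains s i where "s \<in> S" "i \<in> I" "x = inv\<^bsub>Q\<^esub> (\<phi> s) \<otimes>\<^bsub>Q\<^esub> \<phi> i"
  using assms by (auto simp: loc_ideal_def)

lemma loc_ideal_carrier: "x \<in> L \<Longrightarrow> x \<in> carrier Q"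
  by (auto elim!: loc_idealE)

lemma phi_mem_loc_ideal:
  assumes "i \<in> I"
  shows "\<phi> i \<in> L"
  using loc_idealI[OF S_one assms] assms by simp

text \<open>Clearing the denominator in \<open>r/1 = s^-1 i\<close> gives
  \<open>\<phi> (s r) = \<phi> i\<close>. A further factor from \<open>S\<close> lifts this equality
  to \<open>R\<close>. Conversely, \<open>r/1 = s^-1 (s r)\<close>.\<close>

lemma phi_mem_loc_ideal_iff:
  assumes r: "r \<in> carrier R"
  shows "\<phi> r \<in> L \<longleftrightarrow> (\<exists>s\<in>S. s \<otimes> r \<in> I)"
proof
  assume "\<phi> r \<in> L"
  then obtain s i where s: "s \<in> S" and i: "i \<in> I"
    and eq: "\<phi> r = inv\<^bsub>Q\<^esub> (\<phi> s) \<otimes>\<^bsub>Q\<^esub> \<phi> i" by (rule loc_idealE)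
  have "\<phi> (s \<otimes> r) = \<phi> i"
    using s i r by (simp add: eq S.m_assoc[symmetric])
  then have "\<phi> (s \<otimes> r \<ominus> i) = \<zero>\<^bsub>Q\<^esub>"
    using s i r by (simp add: R.minus_eq S.r_neg)
  \<comment> \<open>\<open>\<phi>\<close> need not be injective: its kernel consists of the elements
    that some \<open>t\<close> in \<open>S\<close> kills from the left.\<close>
  then obtain t where t: "t \<in> S" "t \<otimes> (s \<otimes> r \<ominus> i) = \<zero>"
    using s i r phi_eq_zero_iff[of "s \<otimes> r \<ominus> i"] by auto
  then have "t \<otimes> (s \<otimes> r) \<ominus> t \<otimes> i = \<zero>"
    using s i r by (simp add: R.minus_eq R.r_distr R.r_minus)
  then have "t \<otimes> (s \<otimes> r) = t \<otimes> i"
    using s t(1) i r by simp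
  then have "(t \<otimes> s) \<otimes> r \<in> I"
    using s t i r by (simp add: R.m_assoc I.I_l_closed)
  then show "\<exists>s\<in>S. s \<otimes> r \<in> I" using S_mult s t by blast
next
  assume "\<exists>s\<in>S. s \<otimes> r \<in> I"
  then obtain s where s: "s \<in> S" "s \<otimes> r \<in> I" by blast
  then have "inv\<^bsub>Q\<^esub> (\<phi> s) \<otimes>\<^bsub>Q\<^esub> \<phi> (s \<otimes> r) \<in> L" by (rule loc_idealI)
  then show "\<phi> r \<in> L" using s r by (simp add: S.m_assoc[symmetric])
qed

text \<open>\<open>s^-1 (t^-1 i) = (t s)^-1 i\<close>, and \<open>t s\<close> lies in
  \<open>S\<close>.\<close>

lemma loc_ideal_inv_mult:
  assumes "s \<in> S" "x \<in> L"
  shows "inv\<^bsub>Q\<^esub> (\<phi> s) \<otimes>\<^bsub>Q\<^esub> x \<in> L"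
proof -
  obtain t i where t: "t \<in> S" "i \<in> I" "x = inv\<^bsub>Q\<^esub> (\<phi> t) \<otimes>\<^bsub>Q\<^esub> \<phi> i"
    using assms(2) by (rule loc_idealE)
  have "\<phi> (t \<otimes> s) \<otimes>\<^bsub>Q\<^esub> (inv\<^bsub>Q\<^esub> (\<phi> s) \<otimes>\<^bsub>Q\<^esub> x) = \<phi> i"
    using assms(1) t by (simp add: S.m_assoc S.Units_r_inv_cancel)
  then have "inv\<^bsub>Q\<^esub> (\<phi> s) \<otimes>\<^bsub>Q\<^esub> x = inv\<^bsub>Q\<^esub> (\<phi> (t \<otimes> s)) \<otimes>\<^bsub>Q\<^esub> \<phi> i"
    using S.Units_l_inv_cancel[OF unit[OF S_mult[OF t(1) assms(1)]]] assms
      loc_ideal_carrier[OF assms(2)]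
    by (metis S.Units_inv_closed S.m_closed unit)
  then show ?thesis using loc_idealI S_mult assms t by metis
qed

text \<open>The Ore condition gives \<open>r t^-1 = s'^-1 r'\<close>, hence
  \<open>r (t^-1 i) = s'^-1 (r' i)\<close> with \<open>r' i\<close> in \<open>I\<close>.\<close>

lemma loc_ideal_phi_mult:
  assumes "r \<in> carrier R" "x \<in> L"
  shows "\<phi> r \<otimes>\<^bsub>Q\<^esub> x \<in> L"
proof -
  obtain t i where t: "t \<in> S" "i \<in> I" "x = inv\<^bsub>Q\<^esub> (\<phi> t) \<otimes>\<^bsub>Q\<^esub> \<phi> i"
    using assms(2) by (rule loc_idealE)
  obtain s' r' where s': "s' \<in> S" "r' \<in> carrier R" "s' \<otimes> r = r' \<otimes> t"
    using Ore assms(1) t(1) .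
  have "\<phi> r \<otimes>\<^bsub>Q\<^esub> x = \<phi> r \<otimes>\<^bsub>Q\<^esub> inv\<^bsub>Q\<^esub> (\<phi> t) \<otimes>\<^bsub>Q\<^esub> \<phi> i"
    using assms t by (simp add: S.m_assoc)
  also have "\<dots> = inv\<^bsub>Q\<^esub> (\<phi> s') \<otimes>\<^bsub>Q\<^esub> \<phi> (r' \<otimes> i)"
    using assms t s' by (simp add: mult_inv_eq[OF t(1) s'(1) assms(1) s'(2,3)] S.m_assoc)
  finally show ?thesis by (simp only: loc_idealI I.I_l_closed s'(1,2) t(2))
qed

lemma loc_ideal_lmult:
  assumes "q \<in> carrier Q" "x \<in> L"
  shows "q \<otimes>\<^bsub>Q\<^esub> x \<in> L"
proof -
  obtain s r where s: "s \<in> S" "r \<in> carrier R" "q = inv\<^bsub>Q\<^esub> (\<phi> s) \<otimes>\<^bsub>Q\<^esub> \<phi> r"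
    using assms(1) carrier_Q by blast
  then have "q \<otimes>\<^bsub>Q\<^esub> x = inv\<^bsub>Q\<^esub> (\<phi> s) \<otimes>\<^bsub>Q\<^esub> (\<phi> r \<otimes>\<^bsub>Q\<^esub> x)"
    using loc_ideal_carrier[OF assms(2)] by (simp add: S.m_assoc)
  then show ?thesis using s assms loc_ideal_inv_mult loc_ideal_phi_mult by simp
qed

text \<open>No inverse has to be crossed here: \<open>(s^-1 i) r = s^-1 (i r)\<close>, and
  \<open>I\<close> absorbs \<open>r\<close> on the right.\<close>

lemma loc_ideal_rmult_phi:
  assumes "r \<in> carrier R" "x \<in> L"
  shows "x \<otimes>\<^bsub>Q\<^esub> \<phi> r \<in> L"
proof -
  obtain s i where s: "s \<in> S" "i \<in> I" "x = inv\<^bsub>Q\<^esub> (\<phi> s) \<otimes>\<^bsub>Q\<^esub> \<phi> i"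
    using assms(2) by (rule loc_idealE)
  then have "x \<otimes>\<^bsub>Q\<^esub> \<phi> r = inv\<^bsub>Q\<^esub> (\<phi> s) \<otimes>\<^bsub>Q\<^esub> \<phi> (i \<otimes> r)"
    using assms(1) by (simp add: S.m_assoc)
  then show ?thesis by (simp only: loc_idealI I.I_r_closed s(1,2) assms(1))
qed

text \<open>Common denominators: \<open>s\<^sup>-\<^sup>1i + y = s\<^sup>-\<^sup>1(i + sy)\<close>, and \<open>sy \<in> S\<^sup>-\<^sup>1I\<close> may be written \<open>t\<^sup>-\<^sup>1j\<close>.\<close>

lemma loc_ideal_add:
  assumes "x \<in> L" "y \<in> L"
  shows "x \<oplus>\<^bsub>Q\<^esub> y \<in> L"
proof -
  obtain s i where s: "s \<in> S" "i \<in> I" "x = inv\<^bsub>Q\<^esub> (\<phi> s) \<otimes>\<^bsub>Q\<^esub> \<phi> i"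
    using assms(1) by (rule loc_idealE)
  have "\<phi> s \<otimes>\<^bsub>Q\<^esub> y \<in> L"
    using s assms(2) by (simp add: loc_ideal_phi_mult)
  then obtain t j where t: "t \<in> S" "j \<in> I" "\<phi> s \<otimes>\<^bsub>Q\<^esub> y = inv\<^bsub>Q\<^esub> (\<phi> t) \<otimes>\<^bsub>Q\<^esub> \<phi> j"
    by (rule loc_idealE)
  have y: "y = inv\<^bsub>Q\<^esub> (\<phi> s) \<otimes>\<^bsub>Q\<^esub> (inv\<^bsub>Q\<^esub> (\<phi> t) \<otimes>\<^bsub>Q\<^esub> \<phi> j)"
    unfolding t(3)[symmetric]
    using s loc_ideal_carrier[OF assms(2)] by (simp add: S.m_assoc[symmetric])
  have i: "\<phi> i = inv\<^bsub>Q\<^esub> (\<phi> t) \<otimes>\<^bsub>Q\<^esub> \<phi> (t \<otimes> i)"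
    using s t by (simp add: S.m_assoc[symmetric])
  have "x \<oplus>\<^bsub>Q\<^esub> y
      = inv\<^bsub>Q\<^esub> (\<phi> s) \<otimes>\<^bsub>Q\<^esub> (inv\<^bsub>Q\<^esub> (\<phi> t) \<otimes>\<^bsub>Q\<^esub> \<phi> (t \<otimes> i \<oplus> j))"
    unfolding s(3) y by (subst i) (use s t in \<open>simp add: S.r_distr del: hom_mult\<close>)
  also have "\<dots> \<in> L"
    using s t by (intro loc_ideal_inv_mult loc_idealI I.a_closed I.I_l_closed) auto
  finally show ?thesis .
qed

lemma loc_ideal_zero: "\<zero>\<^bsub>Q\<^esub> \<in> L"
  using phi_mem_loc_ideal[OF I.zero_closed] by simp

lemma loc_ideal_additive_subgroup: "subgroup L (add_monoid Q)"
proof (rule S.add.subgroupI)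
  show "\<ominus>\<^bsub>Q\<^esub> x \<in> L" if "x \<in> L" for x
  proof -
    \<comment> \<open>Negation is left multiplication by \<open>-1\<close>, so left absorption
      covers it.\<close>
    have "\<ominus>\<^bsub>Q\<^esub> x = (\<ominus>\<^bsub>Q\<^esub> \<one>\<^bsub>Q\<^esub>) \<otimes>\<^bsub>Q\<^esub> x"
      using loc_ideal_carrier[OF that] by (simp add: S.l_minus)
    then show ?thesis using loc_ideal_lmult that by simp
  qed
qed (use loc_ideal_zero loc_ideal_carrier loc_ideal_add in auto)

section \<open>Criteria for being an ideal: absorption of inverses, and torsion\<close>

text \<open>In a product \<open>(t^-1 i) (s^-1 r)\<close> the outer factors \<open>t^-1\<close> and
  \<open>r\<close> are absorbed by the closure properties above; the obstruction is the middle part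
  \<open>i s^-1\<close>.\<close>

lemma loc_ideal_is_ideal_iff_rmult_inv:
  "ideal L Q \<longleftrightarrow> (\<forall>s\<in>S. \<forall>i\<in>I. \<phi> i \<otimes>\<^bsub>Q\<^esub> inv\<^bsub>Q\<^esub> (\<phi> s) \<in> L)"
proof
  assume "ideal L Q"
  then show "\<forall>s\<in>S. \<forall>i\<in>I. \<phi> i \<otimes>\<^bsub>Q\<^esub> inv\<^bsub>Q\<^esub> (\<phi> s) \<in> L"
    by (simp add: ideal.I_r_closed phi_mem_loc_ideal)
next
  assume inv: "\<forall>s\<in>S. \<forall>i\<in>I. \<phi> i \<otimes>\<^bsub>Q\<^esub> inv\<^bsub>Q\<^esub> (\<phi> s) \<in> L"
  show "ideal L Q"
  proof (rule idealI[OF S.ring_axioms loc_ideal_additive_subgroup])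
    show "q \<otimes>\<^bsub>Q\<^esub> x \<in> L" if "x \<in> L" "q \<in> carrier Q" for x q
      using that loc_ideal_lmult by blast
    show "x \<otimes>\<^bsub>Q\<^esub> q \<in> L" if x: "x \<in> L" and q: "q \<in> carrier Q" for x q
    proof -
      obtain t i where t: "t \<in> S" "i \<in> I" "x = inv\<^bsub>Q\<^esub> (\<phi> t) \<otimes>\<^bsub>Q\<^esub> \<phi> i"
        using x by (rule loc_idealE)
      obtain s r where s: "s \<in> S" "r \<in> carrier R" "q = inv\<^bsub>Q\<^esub> (\<phi> s) \<otimes>\<^bsub>Q\<^esub> \<phi> r"
        using q carrier_Q by blast
      have "x \<otimes>\<^bsub>Q\<^esub> q
          = inv\<^bsub>Q\<^esub> (\<phi> t) \<otimes>\<^bsub>Q\<^esub> (\<phi> i \<otimes>\<^bsub>Q\<^esub> inv\<^bsub>Q\<^esub> (\<phi> s)) \<otimes>\<^bsub>Q\<^esub> \<phi> r"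
        using s t by (simp add: S.m_assoc)
      then show ?thesis
        using inv s t by (simp add: loc_ideal_inv_mult loc_ideal_rmult_phi)
    qed
  qed
qed

text \<open>If inverses are absorbed, \<open>r = (r s) s^-1\<close> puts \<open>r/1\<close> into
  \<open>L\<close>. Conversely, the Ore condition writes \<open>i s^-1\<close> as
  \<open>s'^-1 r'\<close>, and the torsion condition applies to \<open>r'\<close>.\<close>

lemma loc_ideal_is_ideal_iff_torsion:
  "ideal L Q \<longleftrightarrow>
    (\<forall>r\<in>carrier R. \<forall>s\<in>S. r \<otimes> s \<in> I \<longrightarrow> (\<exists>s'\<in>S. s' \<otimes> r \<in> I))"
  unfolding loc_ideal_is_ideal_iff_rmult_inv
proof (intro iffI ballI impI)
  fix r s assume inv: "\<forall>s\<in>S. \<forall>i\<in>I. \<phi> i \<otimes>\<^bsub>Q\<^esub> inv\<^bsub>Q\<^esub> (\<phi> s) \<in> L"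
    and r: "r \<in> carrier R" and s: "s \<in> S" and rs: "r \<otimes> s \<in> I"
  have "\<phi> r = \<phi> (r \<otimes> s) \<otimes>\<^bsub>Q\<^esub> inv\<^bsub>Q\<^esub> (\<phi> s)"
    using r s by (simp add: S.m_assoc)
  then have "\<phi> r \<in> L" using inv s rs by metis
  then show "\<exists>s'\<in>S. s' \<otimes> r \<in> I" using phi_mem_loc_ideal_iff r by blast
next
  fix s i assume tor: "\<forall>r\<in>carrier R. \<forall>s\<in>S. r \<otimes> s \<in> I \<longrightarrow> (\<exists>s'\<in>S. s' \<otimes> r \<in> I)"
    and s: "s \<in> S" and i: "i \<in> I"
  obtain s' r' where s': "s' \<in> S" "r' \<in> carrier R" "s' \<otimes> i = r' \<otimes> s"
    using Ore[OF I.Icarr[OF i] s] .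
  \<comment> \<open>The product equals \<open>s' i\<close>, which lies in \<open>I\<close>; this is
    the premise of the torsion condition for \<open>r'\<close>.\<close>
  have "r' \<otimes> s \<in> I" using s' i by (simp flip: s'(3) add: I.I_l_closed)
  then have "\<phi> r' \<in> L" using tor s s' phi_mem_loc_ideal_iff by blast
  then show "\<phi> i \<otimes>\<^bsub>Q\<^esub> inv\<^bsub>Q\<^esub> (\<phi> s) \<in> L"
    using mult_inv_eq[OF s s'(1) I.Icarr[OF i] s'(2,3)] s' by (simp add: loc_ideal_inv_mult)
qed

text \<open>Each element of \<open>ass_l R S + I\<close> is carried into \<open>I\<close> by some
  \<open>u\<close> in \<open>S\<close> that kills its first summand. The existential over
  \<open>s'\<close> absorbs such extra left factors, since \<open>S\<close> is closed under
  products.\<close>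

lemma torsion_sum_ass_iff:
  "(\<forall>r\<in>carrier R. \<forall>s\<in>S. r \<otimes> s \<in> ass_l R S <+>\<^bsub>R\<^esub> I \<longrightarrow> (\<exists>s'\<in>S. s' \<otimes> r \<in> ass_l R S <+>\<^bsub>R\<^esub> I))
    \<longleftrightarrow> (\<forall>r\<in>carrier R. \<forall>s\<in>S. r \<otimes> s \<in> I \<longrightarrow> (\<exists>s'\<in>S. s' \<otimes> r \<in> I))"
proof -
  have zero: "\<zero> \<in> ass_l R S" using S_one by (auto simp: ass_l_def)
  have I_sub: "i \<in> ass_l R S <+>\<^bsub>R\<^esub> I" if "i \<in> I" for i
    unfolding set_add_def' by (rule UN_I[OF zero], rule UN_I[OF that]) (simp add: that)
  have mult: "\<exists>u\<in>S. u \<otimes> x \<in> I" if x: "x \<in> ass_l R S <+>\<^bsub>R\<^esub> I" for x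
  proof -
    obtain a i where a: "a \<in> ass_l R S" "i \<in> I" "x = a \<oplus> i"
      using x by (auto simp: set_add_def')
    then obtain u where u: "u \<in> S" "a \<in> carrier R" "u \<otimes> a = \<zero>" by (auto simp: ass_l_def)
    then have "u \<otimes> x \<in> I" using a by (simp add: R.r_distr I.I_l_closed)
    then show ?thesis using u by blast
  qed
  show ?thesis
  proof (intro iffI ballI impI)
    fix r s
    assume tor: "\<forall>r\<in>carrier R. \<forall>s\<in>S. r \<otimes> s \<in> ass_l R S <+>\<^bsub>R\<^esub> I \<longrightarrow>
        (\<exists>s'\<in>S. s' \<otimes> r \<in> ass_l R S <+>\<^bsub>R\<^esub> I)"
      and r: "r \<in> carrier R" and s: "s \<in> S" "r \<otimes> s \<in> I"
    then obtain s' where s': "s' \<in> S" "s' \<otimes> r \<in> ass_l R S <+>\<^bsub>R\<^esub> I" using I_sub by blast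
    then obtain u where u: "u \<in> S" "u \<otimes> (s' \<otimes> r) \<in> I" using mult by blast
    then have "(u \<otimes> s') \<otimes> r \<in> I" using r s' by (simp add: R.m_assoc)
    then show "\<exists>s'\<in>S. s' \<otimes> r \<in> I" using S_mult u s' by blast
  next
    fix r s
    assume tor: "\<forall>r\<in>carrier R. \<forall>s\<in>S. r \<otimes> s \<in> I \<longrightarrow> (\<exists>s'\<in>S. s' \<otimes> r \<in> I)"
      and r: "r \<in> carrier R" and s: "s \<in> S" "r \<otimes> s \<in> ass_l R S <+>\<^bsub>R\<^esub> I"
    then obtain u where u: "u \<in> S" "u \<otimes> (r \<otimes> s) \<in> I" using mult by blast
    \<comment> \<open>It is \<open>u r\<close>, not \<open>r\<close> itself, that \<open>s\<close>
      now multiplies into \<open>I\<close>, so the hypothesis is applied to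
      \<open>u r\<close>.\<close>
    then have "(u \<otimes> r) \<otimes> s \<in> I" using r s by (simp add: R.m_assoc)
    then obtain t where t: "t \<in> S" "t \<otimes> (u \<otimes> r) \<in> I"
      using tor s(1) u(1) r by (meson R.m_closed S_carrier)
    then have "(t \<otimes> u) \<otimes> r \<in> ass_l R S <+>\<^bsub>R\<^esub> I" using I_sub u r by (simp add: R.m_assoc)
    then show "\<exists>s'\<in>S. s' \<otimes> r \<in> ass_l R S <+>\<^bsub>R\<^esub> I" using S_mult u t by blast
  qed
qed

section \<open>The ascending chain of left ideals\<close>

lemma loc_ideal_finsum:
  fixes f :: "nat \<Rightarrow> _"
  assumes "\<And>j. j \<le> n \<Longrightarrow> f j \<in> L"
  shows "finsum Q f {..n} \<in> L"
  using assms
proof (induction n)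
  case 0
  then show ?case using loc_ideal_carrier by simp
next
  case (Suc n)
  then have "f \<in> {..Suc n} \<rightarrow> carrier Q" using loc_ideal_carrier by blast
  with Suc show ?case by (simp add: loc_ideal_add)
qed

text \<open>Use the family supported at \<open>j\<close> alone; its other entries are admissible
  because each summand contains \<open>0 = 0 s^-k\<close>.\<close>

lemma loc_chain_superset:
  assumes "s \<in> S" "j \<le> n" "x \<in> L"
  shows "x \<otimes>\<^bsub>Q\<^esub> inv\<^bsub>Q\<^esub> (\<phi> s) [^]\<^bsub>Q\<^esub> j \<in> loc_chain Q \<phi> S I s n"
proof -
  let ?x = "x \<otimes>\<^bsub>Q\<^esub> inv\<^bsub>Q\<^esub> (\<phi> s) [^]\<^bsub>Q\<^esub> j"
  let ?f = "\<lambda>k. if j = k then ?x else \<zero>\<^bsub>Q\<^esub>"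
  have "?x \<in> carrier Q" using assms loc_ideal_carrier by simp
  then have "?x = finsum Q ?f {..n}"
    using S.finsum_singleton[of j "{..n}" "\<lambda>_. ?x"] assms by simp
  moreover have "?f k \<in> L #>\<^bsub>Q\<^esub> inv\<^bsub>Q\<^esub> (\<phi> s) [^]\<^bsub>Q\<^esub> k" for k
  proof (cases "j = k")
    case True
    then show ?thesis using assms(3) by (auto simp: r_coset_def)
  next
    case False
    moreover have "\<zero>\<^bsub>Q\<^esub> = \<zero>\<^bsub>Q\<^esub> \<otimes>\<^bsub>Q\<^esub> inv\<^bsub>Q\<^esub> (\<phi> s) [^]\<^bsub>Q\<^esub> k" using assms(1) by simp
    ultimately show ?thesis using loc_ideal_zero by (auto simp: r_coset_def)
  qed
  ultimately show ?thesis unfolding loc_chain_def by blast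
qed

text \<open>An ideal \<open>L\<close> contains every summand, and the summand for
  \<open>j = 0\<close> is \<open>L\<close> itself, so the chain is constant.\<close>

lemma loc_chain_eq_loc_ideal:
  assumes "ideal L Q" "s \<in> S"
  shows "loc_chain Q \<phi> S I s n = L"
proof
  have "L #>\<^bsub>Q\<^esub> inv\<^bsub>Q\<^esub> (\<phi> s) [^]\<^bsub>Q\<^esub> j \<subseteq> L" for j :: nat
    using assms by (auto simp: r_coset_def ideal.I_r_closed)
  then show "loc_chain Q \<phi> S I s n \<subseteq> L"
    unfolding loc_chain_def using loc_ideal_finsum by blast
  show "L \<subseteq> loc_chain Q \<phi> S I s n"
  proof
    fix x assume x: "x \<in> L"
    then show "x \<in> loc_chain Q \<phi> S I s n"
      using loc_chain_superset[OF assms(2) _ x, of 0 n] loc_ideal_carrier[OF x] by simp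
  qed
qed

text \<open>For \<open>j \<le> n\<close>, \<open>s^-j s^n = s^(n-j)\<close> is the image of an
  element of \<open>R\<close>, which \<open>L\<close> absorbs on the right. Thus the single factor
  \<open>s^n\<close> brings all summands into \<open>L\<close>.\<close>

lemma loc_chain_mult_pow:
  assumes s: "s \<in> S" and x: "x \<in> loc_chain Q \<phi> S I s n"
  shows "x \<otimes>\<^bsub>Q\<^esub> \<phi> s [^]\<^bsub>Q\<^esub> n \<in> L"
proof -
  obtain f where f: "x = finsum Q f {..n}"
    "\<forall>j\<le>n. f j \<in> L #>\<^bsub>Q\<^esub> inv\<^bsub>Q\<^esub> (\<phi> s) [^]\<^bsub>Q\<^esub> j"
    using x by (auto simp: loc_chain_def)
  have mem: "f j \<in> carrier Q \<and> f j \<otimes>\<^bsub>Q\<^esub> \<phi> s [^]\<^bsub>Q\<^esub> n \<in> L" if j: "j \<le> n" for j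
  proof -
    obtain y where y: "y \<in> L" "f j = y \<otimes>\<^bsub>Q\<^esub> inv\<^bsub>Q\<^esub> (\<phi> s) [^]\<^bsub>Q\<^esub> j"
      using f(2) j by (auto simp: r_coset_def)
    have yc: "y \<in> carrier Q" using y loc_ideal_carrier by blast
    have "f j \<otimes>\<^bsub>Q\<^esub> \<phi> s [^]\<^bsub>Q\<^esub> n = y \<otimes>\<^bsub>Q\<^esub> \<phi> (s [^] (n - j))"
      using y yc s j by (simp add: S.m_assoc S.Units_inv_pow_mult_pow hom_nat_pow)
    then show ?thesis using y yc s loc_ideal_rmult_phi by simp
  qed
  have "x \<otimes>\<^bsub>Q\<^esub> \<phi> s [^]\<^bsub>Q\<^esub> n = finsum Q (\<lambda>j. f j \<otimes>\<^bsub>Q\<^esub> \<phi> s [^]\<^bsub>Q\<^esub> n) {..n}"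
    unfolding f(1) using mem s by (intro S.finsum_ldistr) auto
  then show ?thesis using mem by (simp add: loc_ideal_finsum)
qed

lemma loc_ideal_is_ideal_iff_chain:
  "ideal L Q \<longleftrightarrow>
    (\<forall>s\<in>S. \<exists>n. \<forall>i\<ge>n. loc_chain Q \<phi> S I s i = loc_chain Q \<phi> S I s n)"
proof
  assume "ideal L Q"
  then show "\<forall>s\<in>S. \<exists>n. \<forall>i\<ge>n. loc_chain Q \<phi> S I s i = loc_chain Q \<phi> S I s n"
    using loc_chain_eq_loc_ideal by blast
next
  assume stable: "\<forall>s\<in>S. \<exists>n. \<forall>i\<ge>n. loc_chain Q \<phi> S I s i = loc_chain Q \<phi> S I s n"
  show "ideal L Q"
    unfolding loc_ideal_is_ideal_iff_rmult_inv
  proof (intro ballI)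
    fix s i assume s: "s \<in> S" and i: "i \<in> I"
    let ?v = "inv\<^bsub>Q\<^esub> (\<phi> s)"
    obtain n where n: "loc_chain Q \<phi> S I s (Suc n) = loc_chain Q \<phi> S I s n"
      using stable s by (meson le_Suc_eq order_refl)
    \<comment> \<open>The element \<open>i s^-(n+1)\<close> belongs to the term at
      \<open>Suc n\<close>, hence to the term at \<open>n\<close>. Multiplying by
      \<open>s^n\<close>, one power short, leaves exactly one \<open>s^-1\<close>.\<close>
    have "\<phi> i \<otimes>\<^bsub>Q\<^esub> ?v [^]\<^bsub>Q\<^esub> Suc n \<otimes>\<^bsub>Q\<^esub> \<phi> s [^]\<^bsub>Q\<^esub> n \<in> L"
      using loc_chain_superset[OF s order_refl phi_mem_loc_ideal[OF i]] n s
      by (intro loc_chain_mult_pow) metis+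
    moreover have "\<phi> i \<otimes>\<^bsub>Q\<^esub> ?v [^]\<^bsub>Q\<^esub> Suc n \<otimes>\<^bsub>Q\<^esub> \<phi> s [^]\<^bsub>Q\<^esub> n = \<phi> i \<otimes>\<^bsub>Q\<^esub> ?v"
      \<comment> \<open>One inverse is split off at the left, so that the remaining
        \<open>s^-n\<close> stands next to \<open>s^n\<close>.\<close>
      using s i S.Units_inv_pow_mult_pow[OF unit[OF s], of n n] S.nat_pow_Suc2[of ?v n]
      by (simp add: S.m_assoc del: S.nat_pow_Suc)
    ultimately show "\<phi> i \<otimes>\<^bsub>Q\<^esub> ?v \<in> L" by simp
  qed
qed

end

end

section \<open>Each statement shown equivalent to the first\<close>

theorem proposition2p4:
  fixes R :: "('a, 'm) ring_scheme" and Q :: "('b, 'k) ring_scheme"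
    and \<phi> :: "'a \<Rightarrow> 'b" and S \<aa> \<bb> :: "'a set"
  assumes "ring R"
    and "ideal \<aa> R"
    and "S \<in> Den_l R \<aa>"
    and "ideal \<bb> R"
    and "is_left_localization R S Q \<phi>"
  shows
    "(ideal (loc_ideal Q \<phi> S \<bb>) Q \<longleftrightarrow>
        (\<forall>s\<in>S. (\<phi> ` \<bb>) #>\<^bsub>Q\<^esub> (inv\<^bsub>Q\<^esub> (\<phi> s)) \<subseteq> loc_ideal Q \<phi> S \<bb>))
   \<and> (ideal (loc_ideal Q \<phi> S \<bb>) Q \<longleftrightarrow>
        (\<forall>r\<in>carrier R. \<forall>s\<in>S. r \<otimes>\<^bsub>R\<^esub> s \<in> \<bb> \<longrightarrow> (\<exists>s'\<in>S. s' \<otimes>\<^bsub>R\<^esub> r \<in> \<bb>)))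
   \<and> (ideal (loc_ideal Q \<phi> S \<bb>) Q \<longleftrightarrow>
        (\<forall>r\<in>carrier R. \<forall>s\<in>S. r \<otimes>\<^bsub>R\<^esub> s \<in> \<aa> <+>\<^bsub>R\<^esub> \<bb> \<longrightarrow>
           (\<exists>s'\<in>S. s' \<otimes>\<^bsub>R\<^esub> r \<in> \<aa> <+>\<^bsub>R\<^esub> \<bb>)))
   \<and> (ideal (loc_ideal Q \<phi> S \<bb>) Q \<longleftrightarrow>
        (let R' = R Quot \<aa>; \<pi> = (\<lambda>r. \<aa> +>\<^bsub>R\<^esub> r); S' = \<pi> ` S; \<bb>' = \<pi> ` \<bb>
         in tor_r (R' Quot \<bb>') (quot_ract R' \<bb>') S' \<subseteq> tor_l (R' Quot \<bb>') (quot_lact R' \<bb>') S'))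
   \<and> (ideal (loc_ideal Q \<phi> S \<bb>) Q \<longleftrightarrow>
        (\<forall>s\<in>S. \<exists>n. \<forall>i\<ge>n. loc_chain Q \<phi> S \<bb> s i = loc_chain Q \<phi> S \<bb> s n))"
proof -
  have S: "left_denominator_set R S" "ass_l R S = \<aa>"
    using assms(3) by (auto simp: Den_l_def)
  have "ring Q" "\<phi> \<in> ring_hom R Q"
    using assms(5) unfolding is_left_localization_def by blast+
  with assms(1,5) S(1) interpret left_localization R Q \<phi> S
    by (intro left_localization.intro ring_hom_ringI2 left_localization_axioms.intro)
  have right_coset: "(\<forall>s\<in>S. (\<phi> ` \<bb>) #>\<^bsub>Q\<^esub> (inv\<^bsub>Q\<^esub> (\<phi> s)) \<subseteq> loc_ideal Q \<phi> S \<bb>) \<longleftrightarrow>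
      (\<forall>s\<in>S. \<forall>i\<in>\<bb>. \<phi> i \<otimes>\<^bsub>Q\<^esub> inv\<^bsub>Q\<^esub> (\<phi> s) \<in> loc_ideal Q \<phi> S \<bb>)"
    by (auto simp: r_coset_def)
  \<comment> \<open>This settles statement 3. Folded with \<open>torsion_sum_ass_iff\<close> it
    becomes statement 4, which is also the form into which statement 5 is rewritten, so one fact
    closes both.\<close>
  note torsion = loc_ideal_is_ideal_iff_torsion[OF assms(4)]
  show ?thesis
    unfolding Let_def right_coset R.tor_quot_quot_subset_iff[OF assms(2,4) S_subset]
    using loc_ideal_is_ideal_iff_rmult_inv[OF assms(4)] torsion
      torsion[folded torsion_sum_ass_iff[OF assms(4), unfolded S(2)]]
      loc_ideal_is_ideal_iff_chain[OF assms(4)]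
    by (intro conjI)
qed

end
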